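(* Let $(M,\omega)$ be a symplectic manifold, $\nabla$ a torsion-free symplectic connection on $M$, $L\to M$ a complex line bundle with connection $\nabla^L$, and $\Omega=\sum_{i\ge1}\lambda^i\Omega_i$ a formal series of closed two-forms on $M$. Let $\star$ be the Fedosov star product on $C^\infty(M)[[\lambda]]$ built from $\nabla$ and $\Omega$, and let $\star'$ be the Fedosov product on $\Gamma^\infty(\mathrm{End}(L))[[\lambda]]=C^\infty(M)[[\lambda]]$ built from $\nabla$, $\nabla^L$ and the same $\Omega$ (which is also a star product on $M$). Then their characteristic classes are related by $$c(\star')=c(\star)+2\pi\mathrm i\,c_1(L),$$ where $c_1(L)\in H^2_{\mathrm{dR}}(M)$ is the first Chern class of $L$.
   Context: Spaces (all bundles complexified, $\lambda$ a formal parameter): $\mathcal W=\prod_{s\ge0}\Gamma^\infty(\bigvee^sT^*M)[[\lambda]]$, $\mathcal W\otimes\Lambda^\bullet=\prod_s\Gamma^\infty(\bigvee^sT^*M\otimes\bigwedge^\bullet T^*M)[[\lambda]]$. For a line bundle $L$, $\mathrm{End}(L)$ is canonically the trivial line bundle with the trivial induced connection, so $\mathcal W\otimes\Lambda^\bullet\otimes\mathcal End(\mathcal L)=\mathcal W\otimes\Lambda^\bullet$ and $D'=D$ below. Degrees: $\deg_s,\deg_a,\deg_\lambda$ are the symmetric, antisymmetric and $\lambda$-degree; the total degree is $\mathrm{Deg}=2\deg_\lambda+\deg_s$. $\ker\deg_a$ means the elements of antisymmetric degree $0$. $\sigma$ is the projection onto the part of symmetric and antisymmetric degree $0$. Operators: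 $\delta=(1\otimes dx^i)\,i_s(\partial_i)$ and $\delta^*=(dx^i\otimes1)\,i_a(\partial_i)$, with $i_s,i_a$ the symmetric and antisymmetric insertions (in $\delta$ the form $dx^i$ multiplies in the $\bigwedge$ factor, in $\delta^*$ in the $\bigvee$ factor). $\delta^{-1}a=\frac1{k+l}\delta^*a$ if $\deg_sa=ka$, $\deg_aa=la$ with $k+l\neq0$, and $\delta^{-1}a=0$ if $k=l=0$. $D=(1\otimes dx^i)\nabla_{\partial_i}$. Fiberwise Weyl product: $f\circ g=\mu\circ e^{\frac{\mathrm i\lambda}{2}\Lambda^{kl}i_s(\partial_k)\otimes i_s(\partial_l)}(f\otimes g)$ for $f,g\in\mathcal W$, with $\mu$ the symmetric product and $\Lambda^{kl}=-\omega^{kl}$ the Poisson tensor ($\omega^{kl}$ the inverse matrix of $\omega_{kl}$, where $\omega=\frac12\omega_{kl}dx^k\wedge dx^l$), extended to $\mathcal W\otimes\Lambda^\bullet$ by $\wedge$ on forms; $\mathrm{ad}$ is the super-commutator (graded by $\deg_a$) with respect to $\circ$. Expressions with $1/\lambda$ are understood after allowing negative powers of $\lambda$. Curvatures: $R=\frac14\omega_{lm}R^m_{kij}\,dx^l\vee dx^k\otimes dx^i\wedge dx^j$ with $R(\partial_i,\partial_j)\partial_k=R^m_{kij}\partial_m$ the curvature of $\nabla$; $R^L=\frac12dx^i\wedge dx^j\,R^L_{ij}$ is the curvature two-form of $\nabla^L$. The Chern class is $c_1(L)=[\frac{\mathrm i}{2\pi}R^L]$. Fedosov construction: by Fedosov's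 theorem there are unique $r,r'\in\mathcal W\otimes\Lambda^1$ of total degree $\ge3$ with $\delta r=R+Dr+\frac{\mathrm i}{\lambda}r\circ r+\Omega$, $\delta^{-1}r=0$, and $\delta r'=R-\mathrm i\lambda R^L+D'r'+\frac{\mathrm i}{\lambda}r'\circ r'+\Omega$, $\delta^{-1}r'=0$. Put $\mathcal D=-\delta+D+\frac{\mathrm i}{\lambda}\mathrm{ad}(r)$ and $\mathcal D'=-\delta+D'+\frac{\mathrm i}{\lambda}\mathrm{ad}(r')$. Then $\sigma$ restricts to bijections from $\ker\mathcal D\cap\ker\deg_a$ and from $\ker\mathcal D'\cap\ker\deg_a$ onto $C^\infty(M)[[\lambda]]$, with inverses $\tau$ and $\tau'$, and $f\star g=\sigma(\tau(f)\circ\tau(g))$, $f\star'g=\sigma(\tau'(f)\circ\tau'(g))$. Classes: for a Fedosov star product $\star$ obtained from a Fedosov derivative $-\delta+D+\frac{\mathrm i}{\lambda}\mathrm{ad}(r)$, its Fedosov class is the de Rham class $F(\star)=[\omega+\delta r-R-Dr-\frac{\mathrm i}{\lambda}r\circ r]\in H^2_{\mathrm{dR}}(M;\mathbb C)[[\lambda]]$, and its characteristic class is $c(\star)=\frac{1}{\mathrm i\lambda}F(\star)$. The same definitions, with $r'$ in place of $r$, apply to $\star'$. *)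

theory Defs
  imports
    "HOL-Analysis.Analysis"
    "HOL-Library.Function_Algebras"
    "HOL-Library.Set_Algebras"
    "HOL-Computational_Algebra.Formal_Laurent_Series"
begin

section \<open>Smooth manifolds\<close>

text \<open>The manifold is the whole type \<open>'m\<close>, of dimension \<open>CARD('n)\<close>. A chart is a pair of
  its domain and its coordinate map.\<close>

type_synonym ('m, 'n) chart = "'m set \<times> ('m \<Rightarrow> real ^ 'n)"

primrec Ck_on ::
  "nat \<Rightarrow> (real ^ 'n::finite) set \<Rightarrow> (real ^ 'n \<Rightarrow> 'b::real_normed_vector) \<Rightarrow> bool" where
  "Ck_on 0 S f = continuous_on S f"
| "Ck_on (Suc k) S f =
     ((\<forall>x\<in>S. f differentiable at x) \<and>
      (\<forall>i. Ck_on k S (\<lambda>x. frechet_derivative f (at x) (axis i 1))))"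

text \<open>Used for open \<open>S\<close> only.\<close>

definition smooth_on ::
  "(real ^ 'n::finite) set \<Rightarrow> (real ^ 'n \<Rightarrow> 'b::real_normed_vector) \<Rightarrow> bool" where
  "smooth_on S f \<longleftrightarrow> (\<forall>k. Ck_on k S f)"

definition in_chart :: "('m, 'n) chart \<Rightarrow> ('m \<Rightarrow> 'b) \<Rightarrow> real ^ 'n \<Rightarrow> 'b" where
  "in_chart \<phi> f = f \<circ> inv_into (fst \<phi>) (snd \<phi>)"

definition smooth_atlas :: "('m::topological_space, 'n::finite) chart set \<Rightarrow> bool" where
  "smooth_atlas A \<longleftrightarrow>
     (\<Union>\<phi>\<in>A. fst \<phi>) = UNIV \<and>
     (\<forall>\<phi>\<in>A. open (fst \<phi>) \<and> open (snd \<phi> ` fst \<phi>) \<and>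
        homeomorphism (fst \<phi>) (snd \<phi> ` fst \<phi>) (snd \<phi>) (inv_into (fst \<phi>) (snd \<phi>))) \<and>
     (\<forall>\<phi>\<in>A. \<forall>\<psi>\<in>A. smooth_on (snd \<phi> ` (fst \<phi> \<inter> fst \<psi>)) (in_chart \<phi> (snd \<psi>)))"

definition smooth_fun_on ::
  "('m, 'n::finite) chart set \<Rightarrow> 'm set \<Rightarrow> ('m \<Rightarrow> 'b::real_normed_vector) \<Rightarrow> bool" where
  "smooth_fun_on A W f \<longleftrightarrow> (\<forall>\<phi>\<in>A. smooth_on (snd \<phi> ` (fst \<phi> \<inter> W)) (in_chart \<phi> f))"

text \<open>The coordinate derivative \<open>\<partial>\<^sub>i f\<close> at \<open>p\<close> with respect to the chart \<open>\<phi>\<close>.\<close>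

definition pd ::
  "('m, 'n::finite) chart \<Rightarrow> 'n \<Rightarrow> ('m \<Rightarrow> 'b::real_normed_vector) \<Rightarrow> 'm \<Rightarrow> 'b" where
  "pd \<phi> i f p =
     (if p \<in> fst \<phi> then frechet_derivative (in_chart \<phi> f) (at (snd \<phi> p)) (axis i 1) else 0)"

text \<open>\<open>jac \<phi> \<psi> k i p\<close> is \<open>\<partial>x\<^sup>k / \<partial>y\<^sup>i\<close> for \<open>x\<close> the coordinates of \<open>\<phi>\<close> and \<open>y\<close> those of \<open>\<psi>\<close>.\<close>

definition jac ::
  "('m, 'n::finite) chart \<Rightarrow> ('m, 'n) chart \<Rightarrow> 'n \<Rightarrow> 'n \<Rightarrow> 'm \<Rightarrow> real" where
  "jac \<phi> \<psi> k i p = pd \<psi> i (\<lambda>q. snd \<phi> q $ k) p"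


section \<open>Fibres of the bundle of symmetric tensors with values in forms\<close>

text \<open>A fibre element \<open>a\<close> stands for the formal sum, over all index lists \<open>I = [i\<^sub>1,\<dots>,i\<^sub>s]\<close> and
  \<open>J = [j\<^sub>1,\<dots>,j\<^sub>l]\<close>, of
  \<open>1/(s! l!) a I J dx\<^bsup>i\<^sub>1\<^esup> \<or> \<dots> \<or> dx\<^bsup>i\<^sub>s\<^esup> \<otimes> dx\<^bsup>j\<^sub>1\<^esup> \<and> \<dots> \<and> dx\<^bsup>j\<^sub>l\<^esup>\<close>,
  with \<open>a\<close> symmetric in \<open>I\<close> and alternating in \<open>J\<close>. There is no bound on \<open>s\<close>, so this is the
  direct product over all symmetric degrees. Thus a two-form
  \<open>1/2 \<alpha>\<^sub>i\<^sub>j dx\<^sup>i \<and> dx\<^sup>j\<close> has the components \<open>a [] [i, j] = \<alpha>\<^sub>i\<^sub>j\<close>.\<close>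

type_synonym ('n, 'v) fibre = "'n list \<Rightarrow> 'n list \<Rightarrow> 'v"

definition fibre_sym :: "('n, 'v) fibre \<Rightarrow> bool" where
  "fibre_sym a \<longleftrightarrow> (\<forall>I I' J. mset I = mset I' \<longrightarrow> a I J = a I' J)"

definition fibre_alt :: "('n, 'v::ring_1) fibre \<Rightarrow> bool" where
  "fibre_alt a \<longleftrightarrow>
     (\<forall>I J k l. k < l \<and> l < length J \<longrightarrow> a I (J[k := J ! l, l := J ! k]) = - a I J)"

definition remove_nth :: "nat \<Rightarrow> 'a list \<Rightarrow> 'a list" where
  "remove_nth m xs = take m xs @ drop (Suc m) xs"

definition one_fibre :: "('n, 'v::zero_neq_one) fibre" where
  "one_fibre I J = (if I = [] \<and> J = [] then 1 else 0)"

definition ins_s :: "'n \<Rightarrow> ('n, 'v) fibre \<Rightarrow> ('n, 'v) fibre" where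
  "ins_s k a I J = a (k # I) J"

definition ins_a :: "'n \<Rightarrow> ('n, 'v) fibre \<Rightarrow> ('n, 'v) fibre" where
  "ins_a k a I J = a I (k # J)"

text \<open>Left multiplication by \<open>dx\<^sup>k \<otimes> 1\<close> and by \<open>1 \<otimes> dx\<^sup>k\<close>.\<close>

definition dx_s :: "'n \<Rightarrow> ('n, 'v::ring_1) fibre \<Rightarrow> ('n, 'v) fibre" where
  "dx_s k a I J = (\<Sum>m<length I. if I ! m = k then a (remove_nth m I) J else 0)"

definition dx_a :: "'n \<Rightarrow> ('n, 'v::ring_1) fibre \<Rightarrow> ('n, 'v) fibre" where
  "dx_a k a I J = (\<Sum>m<length J. if J ! m = k then (-1) ^ m * a I (remove_nth m J) else 0)"

definition delta_fibre :: "('n::finite, 'v::ring_1) fibre \<Rightarrow> ('n, 'v) fibre" where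
  "delta_fibre a I J = (\<Sum>i\<in>UNIV. dx_a i (ins_s i a) I J)"

definition delta_star_fibre :: "('n::finite, 'v::ring_1) fibre \<Rightarrow> ('n, 'v) fibre" where
  "delta_star_fibre a I J = (\<Sum>i\<in>UNIV. dx_s i (ins_a i a) I J)"

text \<open>The operator \<open>\<delta>\<^sup>*\<close> preserves the sum \<open>k + l\<close> of the symmetric and the antisymmetric degree,
  which can therefore be read off from the result.\<close>

definition delta_inv_fibre :: "('n::finite, complex fps) fibre \<Rightarrow> ('n, complex fps) fibre" where
  "delta_inv_fibre a I J =
     (if length I + length J = 0 then 0
      else fps_const (1 / of_nat (length I + length J)) * delta_star_fibre a I J)"

text \<open>The product \<open>\<or> \<otimes> \<and>\<close> in components is the sum over all ways to distribute the indices
  to the two factors; the sign is that of the shuffle moving the positions in \<open>T\<close> to the front.\<close>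

definition shuffle_sign :: "nat \<Rightarrow> nat set \<Rightarrow> 'v::ring_1" where
  "shuffle_sign n T = (-1) ^ card {(u, t). u < t \<and> t < n \<and> t \<in> T \<and> u \<notin> T}"

definition mult_fibre :: "('n, 'v::ring_1) fibre \<Rightarrow> ('n, 'v) fibre \<Rightarrow> ('n, 'v) fibre" where
  "mult_fibre f g I J =
     (\<Sum>S\<in>Pow {..<length I}. \<Sum>T\<in>Pow {..<length J}.
        shuffle_sign (length J) T *
        (f (nths I S) (nths J T) * g (nths I (- S)) (nths J (- T))))"

definition index_lists :: "nat \<Rightarrow> 'n list set" where
  "index_lists m = {K. length K = m}"

text \<open>The \<open>m\<close>-th term of the exponential series defining the Weyl product for a bivector \<open>P\<close>.
  Iterated symmetric insertion of \<open>K = [k\<^sub>1,\<dots>,k\<^sub>m]\<close> is \<open>\<lambda>I. f (K @ I)\<close>.\<close>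

definition weyl_term ::
  "('n \<Rightarrow> 'n \<Rightarrow> real) \<Rightarrow> nat \<Rightarrow> ('n::finite, complex fps) fibre \<Rightarrow> ('n, complex fps) fibre
   \<Rightarrow> ('n, complex fps) fibre" where
  "weyl_term P m f g I J =
     fps_const (1 / fact m) * (fps_const (\<i> / 2) * fps_X) ^ m *
     (\<Sum>K\<in>index_lists m. \<Sum>L\<in>index_lists m.
        fps_const (of_real (\<Prod>t<m. P (K ! t) (L ! t))) *
        mult_fibre (\<lambda>I. f (K @ I)) (\<lambda>I. g (L @ I)) I J)"

text \<open>The \<open>m\<close>-th term is divisible by \<open>\<lambda>\<^sup>m\<close>, hence only \<open>m \<le> n\<close> contribute to the coefficient
  of \<open>\<lambda>\<^sup>n\<close>.\<close>

definition weyl_fibre ::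
  "('n \<Rightarrow> 'n \<Rightarrow> real) \<Rightarrow> ('n::finite, complex fps) fibre \<Rightarrow> ('n, complex fps) fibre
   \<Rightarrow> ('n, complex fps) fibre" where
  "weyl_fibre P f g I J = Abs_fps (\<lambda>n. fps_nth (\<Sum>m\<le>n. weyl_term P m f g I J) n)"

definition part_a :: "nat \<Rightarrow> ('n, 'v::zero) fibre \<Rightarrow> ('n, 'v) fibre" where
  "part_a l a I J = (if length J = l then a I J else 0)"

text \<open>Super-commutator with respect to the antisymmetric degree.\<close>

definition ad_fibre ::
  "('n \<Rightarrow> 'n \<Rightarrow> real) \<Rightarrow> ('n::finite, complex fps) fibre \<Rightarrow> ('n, complex fps) fibre
   \<Rightarrow> ('n, complex fps) fibre" where
  "ad_fibre P a b I J =
     (\<Sum>k\<le>length J. \<Sum>l\<le>length J.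
        weyl_fibre P (part_a k a) (part_a l b) I J
        - (-1) ^ (k * l) * weyl_fibre P (part_a l b) (part_a k a) I J)"


section \<open>Tensor fields\<close>

text \<open>A field is given by its components in every chart. For uniqueness of the representation the
  components vanish outside of the atlas and outside of the chart domains.\<close>

type_synonym ('m, 'n, 'v) field = "('m, 'n) chart \<Rightarrow> 'm \<Rightarrow> ('n, 'v) fibre"

definition smooth_sections ::
  "('m, 'n::finite) chart set \<Rightarrow> ('m, 'n, 'v::real_normed_field) field set" where
  "smooth_sections A =
     {a. (\<forall>\<phi> p. \<phi> \<notin> A \<or> p \<notin> fst \<phi> \<longrightarrow> (\<forall>I J. a \<phi> p I J = 0)) \<and>
         (\<forall>\<phi>\<in>A. \<forall>I J. smooth_on (snd \<phi> ` fst \<phi>) (in_chart \<phi> (\<lambda>p. a \<phi> p I J))) \<and>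
         (\<forall>\<phi>\<in>A. \<forall>p\<in>fst \<phi>. fibre_sym (a \<phi> p) \<and> fibre_alt (a \<phi> p)) \<and>
         (\<forall>\<phi>\<in>A. \<forall>\<psi>\<in>A. \<forall>p\<in>fst \<phi> \<inter> fst \<psi>. \<forall>I J.
            a \<psi> p I J =
              (\<Sum>I'\<in>index_lists (length I). \<Sum>J'\<in>index_lists (length J).
                 of_real ((\<Prod>m<length I. jac \<phi> \<psi> (I' ! m) (I ! m) p) *
                          (\<Prod>m<length J. jac \<phi> \<psi> (J' ! m) (J ! m) p)) *
                 a \<phi> p I' J'))}"

definition forms ::
  "('m, 'n::finite) chart set \<Rightarrow> nat \<Rightarrow> ('m, 'n, 'v::real_normed_field) field set" where
  "forms A l =
     {a \<in> smooth_sections A. \<forall>\<phi> p I J. I \<noteq> [] \<or> length J \<noteq> l \<longrightarrow> a \<phi> p I J = 0}"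

definition ext_d ::
  "('m, 'n::finite, 'v::real_normed_field) field \<Rightarrow> ('m, 'n, 'v) field" where
  "ext_d a \<phi> p I J = (\<Sum>i\<in>UNIV. dx_a i (\<lambda>I J. pd \<phi> i (\<lambda>q. a \<phi> q I J) p) I J)"

definition lambda_coeff :: "nat \<Rightarrow> ('m, 'n, complex fps) field \<Rightarrow> ('m, 'n, complex) field" where
  "lambda_coeff n a \<phi> p I J = fps_nth (a \<phi> p I J) n"

text \<open>The space \<open>\<W> \<otimes> \<Lambda>\<close>.\<close>

definition weyl_forms ::
  "('m, 'n::finite) chart set \<Rightarrow> ('m, 'n, complex fps) field set" where
  "weyl_forms A = {a. \<forall>n. lambda_coeff n a \<in> smooth_sections A}"

definition deg_a :: "nat \<Rightarrow> ('m, 'n, 'v::zero) field \<Rightarrow> bool" where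
  "deg_a l a \<longleftrightarrow> (\<forall>\<phi> p I J. length J \<noteq> l \<longrightarrow> a \<phi> p I J = 0)"

definition total_deg_ge :: "nat \<Rightarrow> ('m, 'n, complex fps) field \<Rightarrow> bool" where
  "total_deg_ge d a \<longleftrightarrow>
     (\<forall>\<phi> p I J n. 2 * n + length I < d \<longrightarrow> fps_nth (a \<phi> p I J) n = 0)"

definition const_field ::
  "('m, 'n, complex) field \<Rightarrow> ('m, 'n, complex fps) field" where
  "const_field a \<phi> p I J = fps_const (a \<phi> p I J)"

definition complexify :: "('m, 'n, real) field \<Rightarrow> ('m, 'n, complex) field" where
  "complexify a \<phi> p I J = of_real (a \<phi> p I J)"

definition scale_field :: "'v::times \<Rightarrow> ('m, 'n, 'v) field \<Rightarrow> ('m, 'n, 'v) field" where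
  "scale_field c a \<phi> p I J = c * a \<phi> p I J"

definition laurent :: "('m, 'n, complex fps) field \<Rightarrow> ('m, 'n, complex fls) field" where
  "laurent a \<phi> p I J = fps_to_fls (a \<phi> p I J)"

definition i_over_lambda :: "complex fls" where
  "i_over_lambda = fls_const \<i> * fls_X_inv"

definition smooth_series :: "('m, 'n::finite) chart set \<Rightarrow> ('m \<Rightarrow> complex fps) set" where
  "smooth_series A = {f. \<forall>n. smooth_fun_on A UNIV (\<lambda>p. fps_nth (f p) n)}"

definition delta ::
  "('m, 'n::finite, complex fps) field \<Rightarrow> ('m, 'n, complex fps) field" where
  "delta a \<phi> p = delta_fibre (a \<phi> p)"

definition delta_inv ::
  "('m, 'n::finite, complex fps) field \<Rightarrow> ('m, 'n, complex fps) field" where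
  "delta_inv a \<phi> p = delta_inv_fibre (a \<phi> p)"

text \<open>Symmetric and antisymmetric degree \<open>0\<close> components do not depend on the chart.\<close>

definition sigma ::
  "('m, 'n) chart set \<Rightarrow> ('m, 'n, complex fps) field \<Rightarrow> 'm \<Rightarrow> complex fps" where
  "sigma A a p = a (SOME \<phi>. \<phi> \<in> A \<and> p \<in> fst \<phi>) p [] []"


section \<open>Symplectic forms and connections\<close>

definition symplectic_form ::
  "('m, 'n::finite) chart set \<Rightarrow> ('m, 'n, real) field \<Rightarrow> bool" where
  "symplectic_form A \<omega> \<longleftrightarrow>
     \<omega> \<in> forms A 2 \<and> ext_d \<omega> = 0 \<and>
     (\<forall>\<phi>\<in>A. \<forall>p\<in>fst \<phi>. \<forall>v :: real ^ 'n.
        (\<forall>w :: real ^ 'n. (\<Sum>k\<in>UNIV. \<Sum>l\<in>UNIV. v $ k * w $ l * \<omega> \<phi> p [] [k, l]) = 0) \<longrightarrow> v = 0)"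

definition poisson_tensor ::
  "('m, 'n::finite, real) field \<Rightarrow> ('m, 'n) chart \<Rightarrow> 'm \<Rightarrow> 'n \<Rightarrow> 'n \<Rightarrow> real" where
  "poisson_tensor \<omega> \<phi> p k l = - (matrix_inv (\<chi> i j. \<omega> \<phi> p [] [i, j]) $ k $ l)"

text \<open>A connection on the tangent bundle is given by its Christoffel symbols in the charts:
  \<open>\<Gamma> \<phi> k i j p\<close> is \<open>\<Gamma>\<^sup>k\<^sub>i\<^sub>j\<close>, where \<open>\<nabla>\<^bsub>\<partial>\<^sub>i\<^esub> \<partial>\<^sub>j = \<Gamma>\<^sup>k\<^sub>i\<^sub>j \<partial>\<^sub>k\<close>. The transformation law says
  that the local operators agree on overlaps.\<close>

type_synonym ('m, 'n) christoffel = "('m, 'n) chart \<Rightarrow> 'n \<Rightarrow> 'n \<Rightarrow> 'n \<Rightarrow> 'm \<Rightarrow> real"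

definition connection ::
  "('m, 'n::finite) chart set \<Rightarrow> ('m, 'n) christoffel \<Rightarrow> bool" where
  "connection A \<Gamma> \<longleftrightarrow>
     (\<forall>\<phi>\<in>A. \<forall>k i j. smooth_on (snd \<phi> ` fst \<phi>) (in_chart \<phi> (\<Gamma> \<phi> k i j))) \<and>
     (\<forall>\<phi>\<in>A. \<forall>\<psi>\<in>A. \<forall>p\<in>fst \<phi> \<inter> fst \<psi>. \<forall>k a b.
        (\<Sum>c\<in>UNIV. \<Gamma> \<psi> c a b p * jac \<phi> \<psi> k c p) =
        pd \<psi> a (jac \<phi> \<psi> k b) p +
        (\<Sum>i\<in>UNIV. \<Sum>j\<in>UNIV. \<Gamma> \<phi> k i j p * jac \<phi> \<psi> i a p * jac \<phi> \<psi> j b p))"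

definition torsion_free :: "('m, 'n) chart set \<Rightarrow> ('m, 'n) christoffel \<Rightarrow> bool" where
  "torsion_free A \<Gamma> \<longleftrightarrow> (\<forall>\<phi>\<in>A. \<forall>p\<in>fst \<phi>. \<forall>k i j. \<Gamma> \<phi> k i j p = \<Gamma> \<phi> k j i p)"

definition pd_series ::
  "('m, 'n::finite) chart \<Rightarrow> 'n \<Rightarrow> ('m \<Rightarrow> complex fps) \<Rightarrow> 'm \<Rightarrow> complex fps" where
  "pd_series \<phi> i f p = Abs_fps (\<lambda>n. pd \<phi> i (\<lambda>q. fps_nth (f q) n) p)"

definition nabla ::
  "('m, 'n::finite) christoffel \<Rightarrow> ('m, 'n) chart \<Rightarrow> 'n \<Rightarrow> ('m, 'n, complex fps) field
   \<Rightarrow> 'm \<Rightarrow> ('n, complex fps) fibre" where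
  "nabla \<Gamma> \<phi> i a p I J =
     pd_series \<phi> i (\<lambda>q. a \<phi> q I J) p
     - (\<Sum>m<length I. \<Sum>k\<in>UNIV.
          fps_const (of_real (\<Gamma> \<phi> k i (I ! m) p)) * a \<phi> p (I[m := k]) J)
     - (\<Sum>m<length J. \<Sum>k\<in>UNIV.
          fps_const (of_real (\<Gamma> \<phi> k i (J ! m) p)) * a \<phi> p I (J[m := k]))"

definition symplectic_connection ::
  "('m, 'n::finite) chart set \<Rightarrow> ('m, 'n, real) field \<Rightarrow> ('m, 'n) christoffel \<Rightarrow> bool" where
  "symplectic_connection A \<omega> \<Gamma> \<longleftrightarrow>
     connection A \<Gamma> \<and>
     (\<forall>\<phi>\<in>A. \<forall>p\<in>fst \<phi>. \<forall>i. nabla \<Gamma> \<phi> i (const_field (complexify \<omega>)) p = 0)"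

definition cov_D ::
  "('m, 'n::finite) christoffel \<Rightarrow> ('m, 'n, complex fps) field \<Rightarrow> ('m, 'n, complex fps) field" where
  "cov_D \<Gamma> a \<phi> p I J = (\<Sum>i\<in>UNIV. dx_a i (nabla \<Gamma> \<phi> i a p) I J)"

text \<open>\<open>riemann \<Gamma> \<phi> p m k i j\<close> is \<open>R\<^sup>m\<^sub>k\<^sub>i\<^sub>j\<close>, where \<open>R(\<partial>\<^sub>i, \<partial>\<^sub>j) \<partial>\<^sub>k = R\<^sup>m\<^sub>k\<^sub>i\<^sub>j \<partial>\<^sub>m\<close> and
  \<open>R(\<partial>\<^sub>i, \<partial>\<^sub>j) = \<nabla>\<^sub>i \<nabla>\<^sub>j - \<nabla>\<^sub>j \<nabla>\<^sub>i\<close>.\<close>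

definition riemann ::
  "('m, 'n::finite) christoffel \<Rightarrow> ('m, 'n) chart \<Rightarrow> 'm \<Rightarrow> 'n \<Rightarrow> 'n \<Rightarrow> 'n \<Rightarrow> 'n \<Rightarrow> real" where
  "riemann \<Gamma> \<phi> p m k i j =
     pd \<phi> i (\<Gamma> \<phi> m j k) p - pd \<phi> j (\<Gamma> \<phi> m i k) p +
     (\<Sum>q\<in>UNIV. \<Gamma> \<phi> m i q p * \<Gamma> \<phi> q j k p - \<Gamma> \<phi> m j q p * \<Gamma> \<phi> q i k p)"

definition weyl_curvature ::
  "('m, 'n::finite, real) field \<Rightarrow> ('m, 'n) christoffel \<Rightarrow> ('m, 'n, complex fps) field" where
  "weyl_curvature \<omega> \<Gamma> \<phi> p I J =
     (\<Sum>l\<in>UNIV. \<Sum>k\<in>UNIV. \<Sum>i\<in>UNIV. \<Sum>j\<in>UNIV.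
        fps_const (of_real (1 / 4 * (\<Sum>m\<in>UNIV. \<omega> \<phi> p [] [l, m] * riemann \<Gamma> \<phi> p m k i j))) *
        dx_s l (dx_s k (dx_a i (dx_a j one_fibre))) I J)"


section \<open>Complex line bundles with connection\<close>

text \<open>A line bundle has the total space \<open>'l\<close>, a projection, and a family of local trivializations
  \<open>(U, t)\<close>, where \<open>t\<close> is the fibre coordinate on the part over \<open>U\<close>. The linear structure of the
  fibres and the smooth structure of the total space are those induced by the trivializations.\<close>

type_synonym ('l, 'm) trivialization = "'m set \<times> ('l \<Rightarrow> complex)"

record ('l, 'm) line_bundle =
  lb_proj :: "'l \<Rightarrow> 'm"
  lb_trivs :: "('l, 'm) trivialization set"

text \<open>The local frame with fibre coordinate \<open>1\<close>, and the transition function \<open>g\<close> with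
  \<open>s = g t\<close> for the fibre coordinates.\<close>

definition lb_frame :: "('l, 'm) line_bundle \<Rightarrow> ('l, 'm) trivialization \<Rightarrow> 'm \<Rightarrow> 'l" where
  "lb_frame L t p = (THE e. lb_proj L e = p \<and> snd t e = 1)"

definition lb_transition ::
  "('l, 'm) line_bundle \<Rightarrow> ('l, 'm) trivialization \<Rightarrow> ('l, 'm) trivialization \<Rightarrow> 'm \<Rightarrow> complex" where
  "lb_transition L t s p = snd s (lb_frame L t p)"

definition complex_line_bundle ::
  "('m::topological_space, 'n::finite) chart set \<Rightarrow> ('l, 'm) line_bundle \<Rightarrow> bool" where
  "complex_line_bundle A L \<longleftrightarrow>
     (\<Union>t\<in>lb_trivs L. fst t) = UNIV \<and>
     (\<forall>t\<in>lb_trivs L. open (fst t) \<and>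
        bij_betw (\<lambda>e. (lb_proj L e, snd t e)) (lb_proj L -` fst t) (fst t \<times> UNIV)) \<and>
     (\<forall>t\<in>lb_trivs L. \<forall>s\<in>lb_trivs L.
        smooth_fun_on A (fst t \<inter> fst s) (lb_transition L t s) \<and>
        (\<forall>p\<in>fst t \<inter> fst s. lb_transition L t s p \<noteq> 0) \<and>
        (\<forall>e. lb_proj L e \<in> fst t \<inter> fst s \<longrightarrow>
           snd s e = lb_transition L t s (lb_proj L e) * snd t e))"

text \<open>A connection on the line bundle is given by its connection one-forms: for the local frame
  \<open>e\<close> of \<open>t\<close>, one has \<open>\<nabla>\<^bsub>\<partial>\<^sub>i\<^esub> e = \<alpha> t \<phi> i \<cdot> e\<close>. The frame of \<open>s\<close> is \<open>1/g\<close> times the frame of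
  \<open>t\<close>, which gives the sign in the change of trivialization.\<close>

type_synonym ('l, 'm, 'n) lb_conn =
  "('l, 'm) trivialization \<Rightarrow> ('m, 'n) chart \<Rightarrow> 'n \<Rightarrow> 'm \<Rightarrow> complex"

definition line_bundle_connection ::
  "('m, 'n::finite) chart set \<Rightarrow> ('l, 'm) line_bundle \<Rightarrow> ('l, 'm, 'n) lb_conn \<Rightarrow> bool" where
  "line_bundle_connection A L \<alpha> \<longleftrightarrow>
     (\<forall>t\<in>lb_trivs L. \<forall>\<phi>\<in>A. \<forall>i.
        smooth_on (snd \<phi> ` (fst \<phi> \<inter> fst t)) (in_chart \<phi> (\<alpha> t \<phi> i))) \<and>
     (\<forall>t\<in>lb_trivs L. \<forall>\<phi>\<in>A. \<forall>\<psi>\<in>A. \<forall>p\<in>fst t \<inter> fst \<phi> \<inter> fst \<psi>. \<forall>i.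
        \<alpha> t \<psi> i p = (\<Sum>k\<in>UNIV. of_real (jac \<phi> \<psi> k i p) * \<alpha> t \<phi> k p)) \<and>
     (\<forall>t\<in>lb_trivs L. \<forall>s\<in>lb_trivs L. \<forall>\<phi>\<in>A. \<forall>p\<in>fst t \<inter> fst s \<inter> fst \<phi>. \<forall>i.
        \<alpha> s \<phi> i p = \<alpha> t \<phi> i p - pd \<phi> i (lb_transition L t s) p / lb_transition L t s p)"

text \<open>The curvature two-form is locally \<open>R\<^sup>L = d\<alpha>\<close>; the value at \<open>p\<close> does not depend on the
  trivialization around \<open>p\<close>.\<close>

definition lb_curvature ::
  "('m, 'n::finite) chart set \<Rightarrow> ('l, 'm) line_bundle \<Rightarrow> ('l, 'm, 'n) lb_conn
   \<Rightarrow> ('m, 'n, complex) field" where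
  "lb_curvature A L \<alpha> \<phi> p I J =
     (if \<phi> \<in> A \<and> p \<in> fst \<phi> \<and> I = [] \<and> length J = 2
      then let t = (SOME t. t \<in> lb_trivs L \<and> p \<in> fst t); i = J ! 0; j = J ! 1
           in pd \<phi> i (\<alpha> t \<phi> j) p - pd \<phi> j (\<alpha> t \<phi> i) p
      else 0)"


section \<open>De Rham classes\<close>

text \<open>The class of a closed two-form is its coset modulo the exact forms, and elements of
  \<open>H\<^sup>2(M; \<complex>)((\<lambda>))\<close> are given by their coefficients. Sums of classes are sums of sets.\<close>

type_synonym ('m, 'n) H2 = "('m, 'n, complex) field set"
type_synonym ('m, 'n) H2_laurent = "int \<Rightarrow> ('m, 'n) H2"

definition de_rham_class ::
  "('m, 'n::finite) chart set \<Rightarrow> ('m, 'n, complex) field \<Rightarrow> ('m, 'n) H2" where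
  "de_rham_class A a = {a + ext_d b | b. b \<in> forms A 1}"

definition de_rham_class_laurent ::
  "('m, 'n::finite) chart set \<Rightarrow> ('m, 'n, complex fls) field \<Rightarrow> ('m, 'n) H2_laurent" where
  "de_rham_class_laurent A a n = de_rham_class A (\<lambda>\<phi> p I J. fls_nth (a \<phi> p I J) n)"

definition H2_embed ::
  "('m, 'n::finite) chart set \<Rightarrow> ('m, 'n) H2 \<Rightarrow> ('m, 'n) H2_laurent" where
  "H2_embed A c n = (if n = 0 then c else de_rham_class A 0)"

text \<open>Multiplication of classes by a scalar \<open>z \<noteq> 0\<close>.\<close>

definition H2_scale :: "complex \<Rightarrow> ('m, 'n) H2_laurent \<Rightarrow> ('m, 'n) H2_laurent" where
  "H2_scale z c n = scale_field z ` c n"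

definition H2_div_lambda :: "('m, 'n) H2_laurent \<Rightarrow> ('m, 'n) H2_laurent" where
  "H2_div_lambda c n = c (n + 1)"

definition chern_class ::
  "('m, 'n::finite) chart set \<Rightarrow> ('l, 'm) line_bundle \<Rightarrow> ('l, 'm, 'n) lb_conn \<Rightarrow> ('m, 'n) H2" where
  "chern_class A L \<alpha> = de_rham_class A (scale_field (\<i> / (2 * of_real pi)) (lb_curvature A L \<alpha>))"


section \<open>The Fedosov construction\<close>

definition weyl_prod ::
  "('m, 'n::finite, real) field \<Rightarrow> ('m, 'n, complex fps) field \<Rightarrow> ('m, 'n, complex fps) field
   \<Rightarrow> ('m, 'n, complex fps) field" where
  "weyl_prod \<omega> a b \<phi> p = weyl_fibre (poisson_tensor \<omega> \<phi> p) (a \<phi> p) (b \<phi> p)"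

definition ad ::
  "('m, 'n::finite, real) field \<Rightarrow> ('m, 'n, complex fps) field \<Rightarrow> ('m, 'n, complex fps) field
   \<Rightarrow> ('m, 'n, complex fps) field" where
  "ad \<omega> a b \<phi> p = ad_fibre (poisson_tensor \<omega> \<phi> p) (a \<phi> p) (b \<phi> p)"

definition closed_two_form_series ::
  "('m, 'n::finite) chart set \<Rightarrow> ('m, 'n, complex fps) field \<Rightarrow> bool" where
  "closed_two_form_series A \<Omega> \<longleftrightarrow>
     (\<forall>n. lambda_coeff n \<Omega> \<in> forms A 2 \<and> ext_d (lambda_coeff n \<Omega>) = 0) \<and>
     lambda_coeff 0 \<Omega> = 0"

text \<open>\<open>K\<close> is the curvature term of the Fedosov equation.\<close>

definition fedosov_element ::
  "('m, 'n::finite) chart set \<Rightarrow> ('m, 'n, real) field \<Rightarrow> ('m, 'n) christoffel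
   \<Rightarrow> ('m, 'n, complex fps) field \<Rightarrow> ('m, 'n, complex fps) field \<Rightarrow> ('m, 'n, complex fps) field
   \<Rightarrow> bool" where
  "fedosov_element A \<omega> \<Gamma> K \<Omega> r \<longleftrightarrow>
     r \<in> weyl_forms A \<and> deg_a 1 r \<and> total_deg_ge 3 r \<and>
     laurent (delta r) =
       laurent (K + cov_D \<Gamma> r) + scale_field i_over_lambda (laurent (weyl_prod \<omega> r r)) + laurent \<Omega> \<and>
     delta_inv r = 0"

definition fedosov_derivative ::
  "('m, 'n::finite, real) field \<Rightarrow> ('m, 'n) christoffel \<Rightarrow> ('m, 'n, complex fps) field
   \<Rightarrow> ('m, 'n, complex fps) field \<Rightarrow> ('m, 'n, complex fls) field" where
  "fedosov_derivative \<omega> \<Gamma> r a =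
     laurent (- delta a + cov_D \<Gamma> a) + scale_field i_over_lambda (laurent (ad \<omega> r a))"

definition tau ::
  "('m, 'n::finite) chart set \<Rightarrow> ('m, 'n, real) field \<Rightarrow> ('m, 'n) christoffel
   \<Rightarrow> ('m, 'n, complex fps) field \<Rightarrow> ('m \<Rightarrow> complex fps) \<Rightarrow> ('m, 'n, complex fps) field" where
  "tau A \<omega> \<Gamma> r f =
     (THE a. a \<in> weyl_forms A \<and> deg_a 0 a \<and> fedosov_derivative \<omega> \<Gamma> r a = 0 \<and> sigma A a = f)"

text \<open>A Fedosov star product comes with the Fedosov derivative, here given by \<open>r\<close>, that it is
  obtained from; its Fedosov class is defined in terms of the latter.\<close>

record ('m, 'n) star_product =
  star_r :: "('m, 'n, complex fps) field"
  star_mult :: "('m \<Rightarrow> complex fps) \<Rightarrow> ('m \<Rightarrow> complex fps) \<Rightarrow> ('m \<Rightarrow> complex fps)"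

definition fedosov_mult ::
  "('m, 'n::finite) chart set \<Rightarrow> ('m, 'n, real) field \<Rightarrow> ('m, 'n) christoffel
   \<Rightarrow> ('m, 'n) star_product \<Rightarrow> bool" where
  "fedosov_mult A \<omega> \<Gamma> S \<longleftrightarrow>
     (\<forall>f\<in>smooth_series A. \<forall>g\<in>smooth_series A.
        star_mult S f g =
          sigma A (weyl_prod \<omega> (tau A \<omega> \<Gamma> (star_r S) f) (tau A \<omega> \<Gamma> (star_r S) g)))"

definition fedosov_star_product ::
  "('m, 'n::finite) chart set \<Rightarrow> ('m, 'n, real) field \<Rightarrow> ('m, 'n) christoffel
   \<Rightarrow> ('m, 'n, complex fps) field \<Rightarrow> ('m, 'n) star_product \<Rightarrow> bool" where
  "fedosov_star_product A \<omega> \<Gamma> \<Omega> S \<longleftrightarrow>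
     fedosov_element A \<omega> \<Gamma> (weyl_curvature \<omega> \<Gamma>) \<Omega> (star_r S) \<and> fedosov_mult A \<omega> \<Gamma> S"

text \<open>The product on the sections of \<open>End(L)\<close>, which is canonically the trivial line bundle with the
  trivial connection.\<close>

definition fedosov_End_product ::
  "('m, 'n::finite) chart set \<Rightarrow> ('m, 'n, real) field \<Rightarrow> ('m, 'n) christoffel
   \<Rightarrow> ('l, 'm) line_bundle \<Rightarrow> ('l, 'm, 'n) lb_conn
   \<Rightarrow> ('m, 'n, complex fps) field \<Rightarrow> ('m, 'n) star_product \<Rightarrow> bool" where
  "fedosov_End_product A \<omega> \<Gamma> L \<alpha> \<Omega> S \<longleftrightarrow>
     fedosov_element A \<omega> \<Gamma>
       (weyl_curvature \<omega> \<Gamma> - scale_field (fps_const \<i> * fps_X) (const_field (lb_curvature A L \<alpha>)))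
       \<Omega> (star_r S) \<and>
     fedosov_mult A \<omega> \<Gamma> S"

definition fedosov_class ::
  "('m, 'n::finite) chart set \<Rightarrow> ('m, 'n, real) field \<Rightarrow> ('m, 'n) christoffel
   \<Rightarrow> ('m, 'n) star_product \<Rightarrow> ('m, 'n) H2_laurent" where
  "fedosov_class A \<omega> \<Gamma> S =
     de_rham_class_laurent A
       (let r = star_r S in
          laurent (const_field (complexify \<omega>) + delta r - weyl_curvature \<omega> \<Gamma> - cov_D \<Gamma> r)
          - scale_field i_over_lambda (laurent (weyl_prod \<omega> r r)))"

definition characteristic_class ::
  "('m, 'n::finite) chart set \<Rightarrow> ('m, 'n, real) field \<Rightarrow> ('m, 'n) christoffel
   \<Rightarrow> ('m, 'n) star_product \<Rightarrow> ('m, 'n) H2_laurent" where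
  "characteristic_class A \<omega> \<Gamma> S = H2_scale (1 / \<i>) (H2_div_lambda (fedosov_class A \<omega> \<Gamma> S))"

end

theory Submission
  imports Defs
begin

text \<open>Solving the two Fedosov equations for the curvature expression that defines the Fedosov
  class, everything depending on \<open>r\<close> and \<open>r'\<close> cancels: the representatives of the two classes
  are \<open>\<omega> + \<Omega>\<close> and \<open>\<omega> + \<Omega> - \<i>\<lambda>R\<^sup>L\<close>. Dividing by \<open>\<i>\<lambda>\<close>, the characteristic classes differ by
  \<open>-[R\<^sup>L] = 2\<pi>\<i> c\<^sub>1(L)\<close>. What remains is that taking de Rham classes is linear.\<close>

section \<open>Maps of class C^k under sums and bounded linear maps\<close>

lemma Ck_on_cong:
  assumes "open S" "\<And>x. x \<in> S \<Longrightarrow> f x = g x" "Ck_on k S f"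
  shows "Ck_on k S g"
  using assms(2,3)
proof (induction k arbitrary: f g)
  case 0
  then show ?case by (simp cong: continuous_on_cong)
next
  case (Suc k)
  \<comment> \<open>\<open>S\<close> is open, so \<open>f\<close> and \<open>g\<close> agree near
    each of its points. Hence the derivative of \<open>f\<close>, which is taken in the whole space,
    is also that of \<open>g\<close>.\<close>
  have der: "(g has_derivative frechet_derivative f (at x)) (at x)" if "x \<in> S" for x
  proof (rule has_derivative_transform_within_open)
    show "(f has_derivative frechet_derivative f (at x)) (at x)"
      using Suc.prems(2) that by (simp add: frechet_derivative_works)
  qed (use assms(1) that Suc.prems(1) in auto)
  show ?case
    unfolding Ck_on.simps
  proof (intro conjI ballI allI)
    fix x assume "x \<in> S"
    with der show "g differentiable at x" by (blast intro: differentiableI)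
  next
    fix i
    show "Ck_on k S (\<lambda>x. frechet_derivative g (at x) (axis i 1))"
    proof (rule Suc.IH)
      show "Ck_on k S (\<lambda>x. frechet_derivative f (at x) (axis i 1))"
        using Suc.prems(2) by simp
    qed (use der frechet_derivative_at in fastforce)
  qed
qed

text \<open>The sum rule gives the derivative of the sum only at points of \<open>S\<close>, where
  both maps are differentiable. The induction hypothesis thus concerns a map known to agree with the
  partial derivative on \<open>S\<close> alone, and \<open>Ck_on_cong\<close> carries it
  over.\<close>

lemma Ck_on_add:
  assumes "open S" "Ck_on k S f" "Ck_on k S g"
  shows "Ck_on k S (\<lambda>x. f x + g x)"
  using assms(2,3)
proof (induction k arbitrary: f g)
  case 0
  then show ?case by (simp add: continuous_on_add)
next
  case (Suc k)
  have der: "((\<lambda>x. f x + g x) has_derivative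
      (\<lambda>h. frechet_derivative f (at x) h + frechet_derivative g (at x) h)) (at x)"
    if "x \<in> S" for x
    using Suc.prems that
    by (intro has_derivative_add) (simp_all add: frechet_derivative_works)
  show ?case
    unfolding Ck_on.simps
  proof (intro conjI ballI allI)
    fix x assume "x \<in> S"
    with der show "(\<lambda>x. f x + g x) differentiable at x" by (blast intro: differentiableI)
  next
    fix i
    have "Ck_on k S (\<lambda>x. frechet_derivative f (at x) (axis i 1)
        + frechet_derivative g (at x) (axis i 1))"
      using Suc by simp
    then show "Ck_on k S (\<lambda>x. frechet_derivative (\<lambda>x. f x + g x) (at x) (axis i 1))"
      by (rule Ck_on_cong[OF assms(1), rotated]) (simp add: frechet_derivative_at[OF der, symmetric])
  qed
qed

text \<open>A bounded linear map commutes with differentiation, so the same \<open>h\<close> serves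
  at every order. It is applied below to multiplication by a constant.\<close>

lemma Ck_on_bounded_linear:
  assumes "open S" "bounded_linear h" "Ck_on k S f"
  shows "Ck_on k S (\<lambda>x. h (f x))"
  using assms(3)
proof (induction k arbitrary: f)
  case 0
  then show ?case by (simp add: bounded_linear.continuous_on[OF assms(2)])
next
  case (Suc k)
  have der: "((\<lambda>x. h (f x)) has_derivative (\<lambda>v. h (frechet_derivative f (at x) v))) (at x)"
    if "x \<in> S" for x
    using Suc.prems that
    by (intro bounded_linear.has_derivative[OF assms(2)]) (simp add: frechet_derivative_works)
  show ?case
    unfolding Ck_on.simps
  proof (intro conjI ballI allI)
    fix x assume "x \<in> S"
    with der show "(\<lambda>x. h (f x)) differentiable at x" by (blast intro: differentiableI)
  next
    fix i
    have "Ck_on k S (\<lambda>x. h (frechet_derivative f (at x) (axis i 1)))"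
      using Suc by simp
    then show "Ck_on k S (\<lambda>x. frechet_derivative (\<lambda>x. h (f x)) (at x) (axis i 1))"
      by (rule Ck_on_cong[OF assms(1), rotated]) (simp add: frechet_derivative_at[OF der, symmetric])
  qed
qed

lemma smooth_on_zero [simp]:
  "smooth_on S (\<lambda>x. 0 :: 'b::real_normed_vector)"
proof -
  have "Ck_on k S (\<lambda>x. 0 :: 'b)" for k
    by (induction k) simp_all
  then show ?thesis by (simp add: smooth_on_def)
qed

lemma smooth_on_add:
  "open S \<Longrightarrow> smooth_on S f \<Longrightarrow> smooth_on S g \<Longrightarrow> smooth_on S (\<lambda>x. f x + g x)"
  by (simp add: smooth_on_def Ck_on_add)

lemma smooth_on_cmult:
  fixes f :: "real ^ 'n::finite \<Rightarrow> 'b::real_normed_algebra"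
  shows "open S \<Longrightarrow> smooth_on S f \<Longrightarrow> smooth_on S (\<lambda>x. c * f x)"
  by (simp add: smooth_on_def Ck_on_bounded_linear[OF _ bounded_linear_mult_right])

lemma smooth_on_differentiable: "smooth_on S f \<Longrightarrow> x \<in> S \<Longrightarrow> f differentiable at x"
  unfolding smooth_on_def using Ck_on.simps(2) by blast

lemma smooth_atlas_open: "smooth_atlas A \<Longrightarrow> \<phi> \<in> A \<Longrightarrow> open (snd \<phi> ` fst \<phi>)"
  by (simp add: smooth_atlas_def)

section \<open>The vector space of differential forms\<close>

lemma fibre_sym_add:
  assumes "fibre_sym a" "fibre_sym b"
  shows "fibre_sym (a + b)"
  unfolding fibre_sym_def
proof (intro allI impI)
  fix I I' J :: "'a list" assume "mset I = mset I'"
  then have "a I J = a I' J" "b I J = b I' J"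
    using assms unfolding fibre_sym_def by blast+
  then show "(a + b) I J = (a + b) I' J" by simp
qed

lemma fibre_alt_add:
  assumes "fibre_alt a" "fibre_alt b"
  shows "fibre_alt (a + b)"
  unfolding fibre_alt_def
proof (intro allI impI)
  fix I J :: "'a list" and k l
  assume "k < l \<and> l < length J"
  then have "a I (J[k := J ! l, l := J ! k]) = - a I J" "b I (J[k := J ! l, l := J ! k]) = - b I J"
    using assms unfolding fibre_alt_def by blast+
  then show "(a + b) I (J[k := J ! l, l := J ! k]) = - (a + b) I J" by simp
qed

text \<open>Separates the defining conditions, so that the closure proofs for zero, sums and scalar
  multiples can treat them one at a time.\<close>

lemma formsI:
  assumes "\<And>\<phi> p I J. \<phi> \<notin> A \<or> p \<notin> fst \<phi> \<Longrightarrow> a \<phi> p I J = 0"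
    and "\<And>\<phi> p I J. I \<noteq> [] \<or> length J \<noteq> l \<Longrightarrow> a \<phi> p I J = 0"
    and "\<And>\<phi> I J. \<phi> \<in> A \<Longrightarrow> smooth_on (snd \<phi> ` fst \<phi>) (in_chart \<phi> (\<lambda>p. a \<phi> p I J))"
    and "\<And>\<phi> p. \<phi> \<in> A \<Longrightarrow> p \<in> fst \<phi> \<Longrightarrow> fibre_sym (a \<phi> p) \<and> fibre_alt (a \<phi> p)"
    and "\<And>\<phi> \<psi> p I J. \<phi> \<in> A \<Longrightarrow> \<psi> \<in> A \<Longrightarrow> p \<in> fst \<phi> \<inter> fst \<psi> \<Longrightarrow> a \<psi> p I J =
      (\<Sum>I'\<in>index_lists (length I). \<Sum>J'\<in>index_lists (length J).
        of_real ((\<Prod>m<length I. jac \<phi> \<psi> (I' ! m) (I ! m) p) *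
                 (\<Prod>m<length J. jac \<phi> \<psi> (J' ! m) (J ! m) p)) * a \<phi> p I' J')"
  shows "a \<in> forms A l"
  unfolding forms_def smooth_sections_def mem_Collect_eq
  using assms by (intro conjI allI ballI impI) blast+

lemma formsD:
  assumes "a \<in> forms A l"
  shows forms_outside: "\<phi> \<notin> A \<or> p \<notin> fst \<phi> \<Longrightarrow> a \<phi> p I J = 0"
    and forms_degree: "I \<noteq> [] \<or> length J \<noteq> l \<Longrightarrow> a \<phi> p I J = 0"
    and forms_smooth: "\<phi> \<in> A \<Longrightarrow> smooth_on (snd \<phi> ` fst \<phi>) (in_chart \<phi> (\<lambda>p. a \<phi> p I J))"
    and forms_sym_alt: "\<phi> \<in> A \<Longrightarrow> p \<in> fst \<phi> \<Longrightarrow> fibre_sym (a \<phi> p) \<and> fibre_alt (a \<phi> p)"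
    and forms_transform: "\<phi> \<in> A \<Longrightarrow> \<psi> \<in> A \<Longrightarrow> p \<in> fst \<phi> \<inter> fst \<psi> \<Longrightarrow> a \<psi> p I J =
      (\<Sum>I'\<in>index_lists (length I). \<Sum>J'\<in>index_lists (length J).
        of_real ((\<Prod>m<length I. jac \<phi> \<psi> (I' ! m) (I ! m) p) *
                 (\<Prod>m<length J. jac \<phi> \<psi> (J' ! m) (J ! m) p)) * a \<phi> p I' J')"
  using assms unfolding forms_def smooth_sections_def mem_Collect_eq by blast+

lemma zero_in_forms: "0 \<in> forms A l"
  by (rule formsI) (simp_all add: fibre_sym_def fibre_alt_def in_chart_def o_def)

lemma add_in_forms:
  assumes "smooth_atlas A" "a \<in> forms A l" "b \<in> forms A l"
  shows "a + b \<in> forms A l"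
proof (rule formsI)
  fix \<phi> I J assume "\<phi> \<in> A"
  then show "smooth_on (snd \<phi> ` fst \<phi>) (in_chart \<phi> (\<lambda>p. (a + b) \<phi> p I J))"
    using smooth_on_add[OF smooth_atlas_open[OF assms(1)] forms_smooth[OF assms(2)]
        forms_smooth[OF assms(3)]]
    by (simp add: in_chart_def o_def)
next
  fix \<phi> p assume "\<phi> \<in> A" "p \<in> fst \<phi>"
  then show "fibre_sym ((a + b) \<phi> p) \<and> fibre_alt ((a + b) \<phi> p)"
    using forms_sym_alt[OF assms(2)] forms_sym_alt[OF assms(3)]
    by (simp add: fibre_sym_add fibre_alt_add)
next
  fix \<phi> \<psi> p I J assume *: "\<phi> \<in> A" "\<psi> \<in> A" "p \<in> fst \<phi> \<inter> fst \<psi>"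
  show "(a + b) \<psi> p I J =
      (\<Sum>I'\<in>index_lists (length I). \<Sum>J'\<in>index_lists (length J).
        of_real ((\<Prod>m<length I. jac \<phi> \<psi> (I' ! m) (I ! m) p) *
                 (\<Prod>m<length J. jac \<phi> \<psi> (J' ! m) (J ! m) p)) * (a + b) \<phi> p I' J')"
    \<comment> \<open>The transformation law is linear in the components, with Jacobian coefficients
      that are the same for \<open>a\<close> and \<open>b\<close>, so it splits into the two given
      laws.\<close>
    unfolding plus_fun_apply distrib_left sum.distrib
    by (intro arg_cong2[where f = "(+)"] forms_transform[OF assms(2) *]
        forms_transform[OF assms(3) *])
qed (auto simp: forms_outside[OF assms(2)] forms_outside[OF assms(3)]
    forms_degree[OF assms(2)] forms_degree[OF assms(3)])

lemma scale_in_forms: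
  assumes "smooth_atlas A" "a \<in> forms A l"
  shows "scale_field c a \<in> forms A l"
proof (rule formsI)
  fix \<phi> I J assume "\<phi> \<in> A"
  then show "smooth_on (snd \<phi> ` fst \<phi>) (in_chart \<phi> (\<lambda>p. scale_field c a \<phi> p I J))"
    using smooth_on_cmult[OF smooth_atlas_open[OF assms(1)] forms_smooth[OF assms(2)]]
    by (simp add: in_chart_def o_def scale_field_def)
next
  fix \<phi> p assume "\<phi> \<in> A" "p \<in> fst \<phi>"
  from forms_sym_alt[OF assms(2) this]
  show "fibre_sym (scale_field c a \<phi> p) \<and> fibre_alt (scale_field c a \<phi> p)"
    unfolding fibre_sym_def fibre_alt_def scale_field_def by (metis mult_minus_right)
next
  fix \<phi> \<psi> p I J assume *: "\<phi> \<in> A" "\<psi> \<in> A" "p \<in> fst \<phi> \<inter> fst \<psi>"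
  show "scale_field c a \<psi> p I J =
      (\<Sum>I'\<in>index_lists (length I). \<Sum>J'\<in>index_lists (length J).
        of_real ((\<Prod>m<length I. jac \<phi> \<psi> (I' ! m) (I ! m) p) *
                 (\<Prod>m<length J. jac \<phi> \<psi> (J' ! m) (J ! m) p)) * scale_field c a \<phi> p I' J')"
    \<comment> \<open>The constant is moved past the Jacobians and out of both sums, which leaves
      \<open>c\<close> times the law for \<open>a\<close>.\<close>
    unfolding scale_field_def mult.left_commute[of _ c] sum_distrib_left[symmetric]
    by (intro arg_cong[where f = "(*) c"] forms_transform[OF assms(2) *])
qed (auto simp: scale_field_def forms_outside[OF assms(2)] forms_degree[OF assms(2)])

section \<open>Linearity of the exterior derivative and of de Rham classes\<close>

lemma form_differentiable:
  assumes "smooth_atlas A" "a \<in> forms A l" "p \<in> fst \<phi>"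
  shows "in_chart \<phi> (\<lambda>q. a \<phi> q I J) differentiable at (snd \<phi> p)"
proof (cases "\<phi> \<in> A")
  case True
  from smooth_on_differentiable[OF forms_smooth[OF assms(2) this]] assms(3) show ?thesis
    by blast
next
  \<comment> \<open>Equality of fields is tested on all charts, including those outside the atlas.
    There a form vanishes by convention, and its components are constant.\<close>
  case False
  then show ?thesis by (simp add: forms_outside[OF assms(2)] in_chart_def o_def)
qed

text \<open>Membership in \<open>forms\<close> supplies differentiability: without it
  \<open>frechet_derivative\<close> is an unspecified choice and the sum rule may fail. Outside the
  chart domain \<open>pd\<close> is 0 by definition.\<close>

lemma ext_d_add:
  assumes "smooth_atlas A" "a \<in> forms A l" "b \<in> forms A l"
  shows "ext_d (a + b) = ext_d a + ext_d b"
proof -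
  have pd: "pd \<phi> i (\<lambda>q. (a + b) \<phi> q I J) p = pd \<phi> i (\<lambda>q. a \<phi> q I J) p + pd \<phi> i (\<lambda>q. b \<phi> q I J) p"
    for \<phi> i I J p
  proof (cases "p \<in> fst \<phi>")
    case True
    have "((\<lambda>x. in_chart \<phi> (\<lambda>q. a \<phi> q I J) x + in_chart \<phi> (\<lambda>q. b \<phi> q I J) x) has_derivative
      (\<lambda>v. frechet_derivative (in_chart \<phi> (\<lambda>q. a \<phi> q I J)) (at (snd \<phi> p)) v
         + frechet_derivative (in_chart \<phi> (\<lambda>q. b \<phi> q I J)) (at (snd \<phi> p)) v)) (at (snd \<phi> p))"
      using form_differentiable[OF assms(1) _ True] assms(2,3)
      by (intro has_derivative_add) (simp_all add: frechet_derivative_works)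
    from frechet_derivative_at[OF this, symmetric] True show ?thesis
      by (simp add: pd_def in_chart_def o_def)
  qed (simp add: pd_def)
  \<comment> \<open>Both sides are sums over a direction and a position in \<open>J\<close>; they
    agree term by term.\<close>
  show ?thesis
    by (intro ext) (simp add: ext_d_def dx_a_def pd[unfolded plus_fun_apply]
        flip: sum.distrib, intro sum.cong refl, simp add: distrib_left)
qed

lemma ext_d_scale:
  assumes "smooth_atlas A" "a \<in> forms A l"
  shows "ext_d (scale_field c a) = scale_field c (ext_d a)"
proof -
  have pd: "pd \<phi> i (\<lambda>q. scale_field c a \<phi> q I J) p = c * pd \<phi> i (\<lambda>q. a \<phi> q I J) p" for \<phi> i I J p
  proof (cases "p \<in> fst \<phi>")
    case True
    have "((\<lambda>x. c * in_chart \<phi> (\<lambda>q. a \<phi> q I J) x) has_derivative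
      (\<lambda>v. c * frechet_derivative (in_chart \<phi> (\<lambda>q. a \<phi> q I J)) (at (snd \<phi> p)) v)) (at (snd \<phi> p))"
      using form_differentiable[OF assms(1,2) True]
      by (intro has_derivative_mult_right) (simp add: frechet_derivative_works)
    from frechet_derivative_at[OF this, symmetric] True show ?thesis
      by (simp add: pd_def in_chart_def o_def scale_field_def)
  qed (simp add: pd_def)
  show ?thesis
    by (intro ext) (simp add: ext_d_def dx_a_def pd scale_field_def[of c "ext_d a"]
        sum_distrib_left if_distrib mult.left_commute cong: if_cong)
qed

text \<open>Classes are cosets of the exact forms, which contain zero and are closed under addition.
  Only the potentials are differentiated, so the representatives may be arbitrary fields and the
  main proof need not show that its own are forms.\<close>

lemma de_rham_class_add:
  assumes "smooth_atlas A"
  shows "de_rham_class A (a + b) = de_rham_class A a + de_rham_class A b"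
proof (intro set_eqI iffI)
  fix x assume "x \<in> de_rham_class A (a + b)"
  then obtain c where c: "c \<in> forms A 1" "x = a + b + ext_d c"
    by (auto simp: de_rham_class_def)
  \<comment> \<open>Additivity at zero and cancellation. The whole potential \<open>c\<close> can
    then go to the first summand and the potential \<open>0\<close> to the second.\<close>
  have "ext_d (0 :: ('a, 'b, complex) field) = 0"
    using ext_d_add[OF assms zero_in_forms zero_in_forms] by simp
  with c have "x = (a + ext_d c) + (b + ext_d 0)"
    by (simp add: ac_simps)
  then show "x \<in> de_rham_class A a + de_rham_class A b"
    using c(1) zero_in_forms unfolding de_rham_class_def by blast
next
  fix x assume "x \<in> de_rham_class A a + de_rham_class A b"
  then obtain c d where cd: "c \<in> forms A 1" "d \<in> forms A 1"
    "x = (a + ext_d c) + (b + ext_d d)"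
    by (auto simp: de_rham_class_def elim!: set_plus_elim)
  then have "x = a + b + ext_d (c + d)"
    by (simp add: ext_d_add[OF assms cd(1,2)] ac_simps)
  then show "x \<in> de_rham_class A (a + b)"
    using add_in_forms[OF assms cd(1,2)] unfolding de_rham_class_def by blast
qed

lemma scale_field_add:
  "scale_field (c :: 'v::semiring) (a + b) = scale_field c a + scale_field c b"
  by (intro ext) (simp add: scale_field_def distrib_left)

lemma scale_field_scale_field:
  "scale_field (c :: 'v::semigroup_mult) (scale_field d a) = scale_field (c * d) a"
  by (intro ext) (simp add: scale_field_def mult.assoc)

text \<open>Scaling by a nonzero constant permutes the exact forms, as potentials can be scaled
  back. For \<open>c = 0\<close> the image would be just zero, not the coset of all exact
  forms.\<close>

lemma de_rham_class_scale:
  assumes "smooth_atlas A" "c \<noteq> 0"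
  shows "scale_field c ` de_rham_class A a = de_rham_class A (scale_field c a)"
proof (intro set_eqI iffI)
  fix x assume "x \<in> scale_field c ` de_rham_class A a"
  then obtain b where b: "b \<in> forms A 1" "x = scale_field c (a + ext_d b)"
    by (auto simp: de_rham_class_def)
  then have "x = scale_field c a + ext_d (scale_field c b)"
    by (simp add: ext_d_scale[OF assms(1) b(1)] scale_field_add)
  then show "x \<in> de_rham_class A (scale_field c a)"
    using scale_in_forms[OF assms(1) b(1)] unfolding de_rham_class_def by blast
next
  fix x assume "x \<in> de_rham_class A (scale_field c a)"
  then obtain b where b: "b \<in> forms A 1" "x = scale_field c a + ext_d b"
    by (auto simp: de_rham_class_def)
  \<comment> \<open>The potential of the preimage is \<open>b\<close> divided by
    \<open>c\<close>.\<close>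
  have "scale_field c (ext_d (scale_field (inverse c) b)) = ext_d b"
    using assms(2)
    by (intro ext) (simp add: ext_d_scale[OF assms(1) b(1)] scale_field_def)
  with b(2) have "x = scale_field c (a + ext_d (scale_field (inverse c) b))"
    by (simp add: scale_field_add)
  then show "x \<in> scale_field c ` de_rham_class A a"
    using scale_in_forms[OF assms(1) b(1)] unfolding de_rham_class_def by blast
qed

section \<open>Fedosov classes and the comparison of the characteristic classes\<close>

lemma fedosov_class_eq:
  assumes "fedosov_element A \<omega> \<Gamma> (weyl_curvature \<omega> \<Gamma> + K) \<Omega> (star_r S)"
  shows "fedosov_class A \<omega> \<Gamma> S =
    de_rham_class_laurent A (laurent (const_field (complexify \<omega>) + \<Omega> + K))"
proof -
  define r where "r = star_r S"
  \<comment> \<open>The term \<open>K\<close> lets one computation serve both products: it is 0 for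
    \<open>star\<close> and -\<i>\<lambda>R^L for \<open>star'\<close>. The Fedosov equation is read
    off componentwise, where it relates Laurent series.\<close>
  have eq: "laurent (delta r) \<phi> p I J =
      laurent (weyl_curvature \<omega> \<Gamma> + K + cov_D \<Gamma> r) \<phi> p I J
      + scale_field i_over_lambda (laurent (weyl_prod \<omega> r r)) \<phi> p I J + laurent \<Omega> \<phi> p I J"
    for \<phi> p I J
    using assms unfolding fedosov_element_def r_def by simp
  \<comment> \<open>Substituting for \<open>delta r\<close> cancels the Weyl curvature, the
    covariant derivative and the quadratic term.\<close>
  have "laurent (const_field (complexify \<omega>) + delta r - weyl_curvature \<omega> \<Gamma> - cov_D \<Gamma> r)
      - scale_field i_over_lambda (laurent (weyl_prod \<omega> r r)) =
      laurent (const_field (complexify \<omega>) + \<Omega> + K)"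
  proof (intro ext)
    fix \<phi> p I J
    show "(laurent (const_field (complexify \<omega>) + delta r - weyl_curvature \<omega> \<Gamma> - cov_D \<Gamma> r)
      - scale_field i_over_lambda (laurent (weyl_prod \<omega> r r))) \<phi> p I J =
      laurent (const_field (complexify \<omega>) + \<Omega> + K) \<phi> p I J"
      using eq[of \<phi> p I J]
      by (simp add: laurent_def)
  qed
  then show ?thesis
    by (simp add: fedosov_class_def r_def)
qed

theorem corollary2:
  fixes A :: "('m::{t2_space, second_countable_topology}, 'n::finite) chart set"
    and \<omega> :: "('m, 'n, real) field"
    and \<Gamma> :: "('m, 'n) christoffel"
    and L :: "('l, 'm) line_bundle"
    and \<alpha> :: "('l, 'm, 'n) lb_conn"
    and \<Omega> :: "('m, 'n, complex fps) field"
    and star star' :: "('m, 'n) star_product"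
  assumes "smooth_atlas A"
    and "symplectic_form A \<omega>"
    and "symplectic_connection A \<omega> \<Gamma>" and "torsion_free A \<Gamma>"
    and "complex_line_bundle A L" and "line_bundle_connection A L \<alpha>"
    and "closed_two_form_series A \<Omega>"
    and "fedosov_star_product A \<omega> \<Gamma> \<Omega> star"
    and "fedosov_End_product A \<omega> \<Gamma> L \<alpha> \<Omega> star'"
  shows "characteristic_class A \<omega> \<Gamma> star' =
         characteristic_class A \<omega> \<Gamma> star +
         H2_scale (2 * of_real pi * \<i>) (H2_embed A (chern_class A L \<alpha>))"
proof
  \<comment> \<open>Laurent series of classes are functions of the exponent, so the coefficients of
    \<lambda>^n are compared.\<close>
  fix n
  define F where "F = const_field (complexify \<omega>) + \<Omega>"
  define RL where "RL = lb_curvature A L \<alpha>"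
  define K where "K = - scale_field (fps_const \<i> * fps_X) (const_field RL)"
  \<comment> \<open>The index is \<open>n + 1\<close> because the characteristic class divides the
    Fedosov class by \<lambda>.\<close>
  define F\<^sub>n where "F\<^sub>n = (\<lambda>\<phi> p I J. fls_nth (laurent F \<phi> p I J) (n + 1))"
  define K\<^sub>n where "K\<^sub>n = (\<lambda>\<phi> p I J. fls_nth (laurent K \<phi> p I J) (n + 1))"
  note atlas = \<open>smooth_atlas A\<close>
  have scale_nz: "scale_field (1 / \<i>) ` de_rham_class A a = de_rham_class A (scale_field (1 / \<i>) a)"
    for a
    by (rule de_rham_class_scale[OF atlas]) simp
  have "fedosov_element A \<omega> \<Gamma> (weyl_curvature \<omega> \<Gamma> + 0) \<Omega> (star_r star)"
    using \<open>fedosov_star_product A \<omega> \<Gamma> \<Omega> star\<close> by (simp add: fedosov_star_product_def)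
  from fedosov_class_eq[OF this]
  have star: "characteristic_class A \<omega> \<Gamma> star n = scale_field (1 / \<i>) ` de_rham_class A F\<^sub>n"
    by (simp add: characteristic_class_def H2_scale_def H2_div_lambda_def
        de_rham_class_laurent_def F_def F\<^sub>n_def)
  have "fedosov_element A \<omega> \<Gamma> (weyl_curvature \<omega> \<Gamma> + K) \<Omega> (star_r star')"
    using \<open>fedosov_End_product A \<omega> \<Gamma> L \<alpha> \<Omega> star'\<close>
    by (simp add: fedosov_End_product_def K_def RL_def)
  from fedosov_class_eq[OF this]
  have "characteristic_class A \<omega> \<Gamma> star' n =
      scale_field (1 / \<i>) ` de_rham_class A (\<lambda>\<phi> p I J. fls_nth (laurent (F + K) \<phi> p I J) (n + 1))"
    by (simp add: characteristic_class_def H2_scale_def H2_div_lambda_def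
        de_rham_class_laurent_def F_def)
  also have "(\<lambda>\<phi> p I J. fls_nth (laurent (F + K) \<phi> p I J) (n + 1)) = F\<^sub>n + K\<^sub>n"
    by (intro ext) (simp add: F\<^sub>n_def K\<^sub>n_def laurent_def)
  \<comment> \<open>With the scalar moved inside the cosets, linearity splits off the contribution
    of \<open>F\<^sub>n\<close>, which is the class of \<open>star\<close>.\<close>
  finally have star': "characteristic_class A \<omega> \<Gamma> star' n =
      characteristic_class A \<omega> \<Gamma> star n + de_rham_class A (scale_field (1 / \<i>) K\<^sub>n)"
    unfolding star scale_nz scale_field_add by (simp only: de_rham_class_add[OF atlas])
  \<comment> \<open>The only coefficient of \<open>K\<close> is that of \<lambda>^1, which the shift
    places at \<open>n = 0\<close>; there (1/\<i>)(-\<i>) = -1.\<close>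
  have "scale_field (1 / \<i>) K\<^sub>n = (if n = 0 then scale_field (-1) RL else 0)"
  proof (intro ext)
    fix \<phi> p I J
    \<comment> \<open>Coefficients of an embedded power series at a nonnegative integer are indexed
      through \<open>nat\<close>; this locates the coefficient of \<open>fps_X\<close>.\<close>
    have "nat (n + 1) = 1 \<longleftrightarrow> n = 0" by auto
    then show "scale_field (1 / \<i>) K\<^sub>n \<phi> p I J = (if n = 0 then scale_field (-1) RL else 0) \<phi> p I J"
      by (auto simp: K\<^sub>n_def K_def scale_field_def laurent_def const_field_def mult.assoc
          split: if_splits)
  qed
  \<comment> \<open>At \<open>n = 0\<close> the constants give 2\<pi>\<i> \<cdot> \<i>/(2\<pi>) =
    -1, so this is the same class. Elsewhere it is the zero class, the set of exact forms, which
    scaling preserves.\<close>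
  moreover have "H2_scale (2 * of_real pi * \<i>) (H2_embed A (chern_class A L \<alpha>)) n =
      de_rham_class A (if n = 0 then scale_field (-1) RL else 0)"
  proof -
    have "scale_field (2 * of_real pi * \<i>) (0 :: ('m, 'n, complex) field) = 0"
      by (intro ext) (simp add: scale_field_def)
    then show ?thesis
      by (simp add: H2_scale_def H2_embed_def chern_class_def RL_def
          de_rham_class_scale[OF atlas] scale_field_scale_field)
  qed
  ultimately show "characteristic_class A \<omega> \<Gamma> star' n =
      (characteristic_class A \<omega> \<Gamma> star +
       H2_scale (2 * of_real pi * \<i>) (H2_embed A (chern_class A L \<alpha>))) n"
    by (simp add: star')
qed

end
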